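(* Suppose that the mirror map $\chi$ satisfies Assumptions 1 and 2 stated in the context. Let $x^\star$ be a minimizer of $f$ over $\mathcal{X}$, let $$\widehat V(x,\zeta,t)=\frac{t^2}{r^2}\big(f(x)-f(x^\star)\big)+D_\phi\big(x^\star,\chi(\zeta)\big),$$ and let $\delta=\sqrt h$. If $f$ is $L_f$-smooth (i.e. $\|\nabla f(x)-\nabla f(y)\|_\star\le L_f\|x-y\|$ for all $x,y$ in the domain of $f$), $\gamma\ge L_RL_\chi$ and $h\le \ell_R/(2L_f\gamma)$, then for the iterates $(x_k,\zeta_k)$ of the AMDR algorithm, for $k=0,1,\dots$, $$\widehat V(x_{k+1},\zeta_{k+1},(k+1)\delta)-\widehat V(x_k,\zeta_k,k\delta)\le\frac{(2k+1-kr)h}{r^2}\big(f(x_{k+1})-f(x^\star)\big).$$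
   Context: $\mathbb{E}$ denotes $\mathbb{R}^d$ with an arbitrary norm $\|\cdot\|$, $\mathbb{E}^\star$ is its dual with dual norm $\|\cdot\|_\star$, and $\langle\zeta,x\rangle=\sum_j\zeta_jx_j$ is the pairing between $\zeta\in\mathbb{E}^\star$ and $x\in\mathbb{E}$. The set $\mathcal{X}\subseteq\mathbb{R}^d$ is non-empty, closed and convex, with relative interior $\mathrm{ri}(\mathcal{X})$ and indicator function $\delta_{\mathcal{X}}$ ($0$ on $\mathcal{X}$, $\infty$ elsewhere); $f$ is a real-valued function that is convex and continuously differentiable in an open set containing $\mathcal{X}$; $\nabla f(x)\in\mathbb{E}^\star$. Assumption 1: $\chi=\nabla\psi^\star$ for some convex and differentiable $\psi^\star:\mathbb{E}^\star\to\mathbb{R}$, $\chi$ takes values in $\mathcal{X}$, and $\|\chi(\xi)-\chi(\zeta)\|\le L_\chi\|\xi-\zeta\|_\star$ for all $\xi,\zeta\in\mathbb{E}^\star$. Assumption 2: $\chi=\nabla\psi^\star$ is differentiable and its image is $\mathrm{ri}(\mathcal{X})$. In addition, $\psi^\star$ is the convex conjugate of $\psi=\phi+\delta_{\mathcal{X}}$ (i.e. $\psi^\star(\zeta)=\sup_{x\in\mathbb{E}}\{\langle\zeta,x\rangle-\psi(x)\}$), where $\phi:\mathbb{E}\to(-\infty,\infty]$ is proper, convex, differentiable over $\mathrm{ri}(\mathcal{X})$ and satisfies $\mathcal{X}\subseteq\mathrm{dom}(\phi)$. Primal Bregman divergence: for $x\in\mathcal{X}$, $z\in\mathrm{ri}(\mathcal{X})$,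 $D_\phi(x,z)=\phi(x)-\phi(z)-\langle\nabla\phi(z),x-z\rangle$. AMDR (Accelerated Mirror Descent with Regularization) uses a learning rate $h>0$, parameters $r>0$, $\gamma>0$, and a regularization function $R$ such that, for $x,y\in\mathcal{X}$, $\frac{\ell_R}{2}\|x-y\|^2\le R(x,y)\le\frac{L_R}{2}\|x-y\|^2$ (with constants $0<\ell_R\le L_R$). Initialize $x_0\in\mathcal{X}$, $\zeta_0\in\mathbb{E}^\star$ with $\chi(\zeta_0)=x_0$. For $k=0,1,\dots$: $$y_k=x_k+\frac{r}{r+k}\big(\chi(\zeta_k)-x_k\big),\qquad \zeta_{k+1}=\zeta_k-\frac{kh}{r}\nabla f(y_k),$$ $$x_{k+1}\in\operatorname{argmin}_{x\in\mathcal{X}}\big(\gamma h\langle\nabla f(y_k),x\rangle+R(x,y_k)\big)$$ (the minimizer being assumed to exist). *)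

theory Defs
  imports "HOL-Analysis.Analysis"
begin

text \<open>
  The space \<open>\<real>\<^sup>d\<close> is \<open>real ^ 'n\<close> with \<open>d = CARD('n)\<close>. The norm of the primal space is an
  arbitrary function \<open>N\<close> satisfying the norm axioms; the dual space is identified with
  \<open>real ^ 'n\<close> as well, so that the pairing is the inner product \<open>\<bullet>\<close> and the dual norm is
  \<open>dual_norm N\<close>.
\<close>

definition is_norm :: "('a::real_vector \<Rightarrow> real) \<Rightarrow> bool" where
  "is_norm N \<longleftrightarrow>
     (\<forall>x. 0 \<le> N x) \<and> (\<forall>x. N x = 0 \<longleftrightarrow> x = 0) \<and>
     (\<forall>c x. N (c *\<^sub>R x) = \<bar>c\<bar> * N x) \<and>
     (\<forall>x y. N (x + y) \<le> N x + N y)"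

definition dual_norm :: "('a::real_inner \<Rightarrow> real) \<Rightarrow> 'a \<Rightarrow> real" where
  "dual_norm N \<zeta> = Sup {\<zeta> \<bullet> x | x. N x \<le> 1}"

text \<open>Meaningful only where \<open>f\<close> is differentiable, see \<open>GDERIV_grad\<close>.\<close>

definition grad :: "('a::real_inner \<Rightarrow> real) \<Rightarrow> 'a \<Rightarrow> 'a" where
  "grad f x = (THE D. GDERIV f x :> D)"

lemma GDERIV_grad:
  fixes f :: "'a::euclidean_space \<Rightarrow> real"
  assumes "f differentiable (at x)"
  shows "GDERIV f x :> grad f x"
proof -
  obtain f' where f': "(f has_derivative f') (at x)"
    using assms by (auto simp: differentiable_def)
  interpret linear f' using f' by (rule has_derivative_linear)
  define D where "D = (\<Sum>b\<in>Basis. f' b *\<^sub>R b)"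
  have "f' = (\<lambda>v. v \<bullet> D)"
  proof
    fix v
    have "f' v = f' (\<Sum>b\<in>Basis. (v \<bullet> b) *\<^sub>R b)" by (simp add: euclidean_representation)
    also have "\<dots> = (\<Sum>b\<in>Basis. (v \<bullet> b) * f' b)" by (simp add: sum scale)
    also have "\<dots> = v \<bullet> D" by (simp add: D_def inner_sum_right mult.commute)
    finally show "f' v = v \<bullet> D" .
  qed
  then have D: "GDERIV f x :> D"
    using f' unfolding gderiv_def by presburger
  have "D' = D" if "GDERIV f x :> D'" for D'
  proof -
    have "(\<lambda>v. v \<bullet> D') = (\<lambda>v. v \<bullet> D)"
      using that D unfolding gderiv_def by (rule has_derivative_unique)
    then have "(D' - D) \<bullet> D' = (D' - D) \<bullet> D" by metis
    then have "(D' - D) \<bullet> (D' - D) = 0" by (simp add: inner_diff_right)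
    then show ?thesis by simp
  qed
  then show ?thesis unfolding grad_def using D by (metis theI)
qed

definition ereal_proper :: "('a \<Rightarrow> ereal) \<Rightarrow> bool" where
  "ereal_proper \<phi> \<longleftrightarrow> (\<forall>x. \<phi> x \<noteq> -\<infinity>) \<and> (\<exists>x. \<phi> x \<noteq> \<infinity>)"

text \<open>Only used for functions that never take the value \<open>-\<infinity>\<close>.\<close>

definition ereal_convex :: "('a::real_vector \<Rightarrow> ereal) \<Rightarrow> bool" where
  "ereal_convex \<phi> \<longleftrightarrow>
     (\<forall>x y. \<forall>u::real. 0 < u \<and> u < 1 \<longrightarrow>
        \<phi> (u *\<^sub>R x + (1 - u) *\<^sub>R y) \<le> ereal u * \<phi> x + ereal (1 - u) * \<phi> y)"

definition eff_dom :: "('a \<Rightarrow> ereal) \<Rightarrow> 'a set" where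
  "eff_dom \<phi> = {x. \<phi> x < \<infinity>}"

text \<open>
  Differentiability, in the full space, of an extended-real-valued function: it must be
  finite in a neighbourhood of the point.
\<close>

definition ereal_differentiable_at :: "('a::real_normed_vector \<Rightarrow> ereal) \<Rightarrow> 'a \<Rightarrow> bool" where
  "ereal_differentiable_at \<phi> z \<longleftrightarrow>
     (\<forall>\<^sub>F x in nhds z. \<bar>\<phi> x\<bar> \<noteq> \<infinity>) \<and> (\<lambda>x. real_of_ereal (\<phi> x)) differentiable (at z)"

definition ereal_grad :: "('a::real_inner \<Rightarrow> ereal) \<Rightarrow> 'a \<Rightarrow> 'a" where
  "ereal_grad \<phi> z = grad (\<lambda>x. real_of_ereal (\<phi> x)) z"

definition set_indicator :: "'a set \<Rightarrow> 'a \<Rightarrow> ereal" where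
  "set_indicator X x = (if x \<in> X then 0 else \<infinity>)"

definition convex_conjugate :: "('a::real_inner \<Rightarrow> ereal) \<Rightarrow> 'a \<Rightarrow> ereal" where
  "convex_conjugate \<psi> \<zeta> = (SUP x. ereal (\<zeta> \<bullet> x) - \<psi> x)"

definition mirror_assumption1 ::
    "('a::real_inner \<Rightarrow> real) \<Rightarrow> 'a set \<Rightarrow> ('a \<Rightarrow> 'a) \<Rightarrow> ('a \<Rightarrow> real) \<Rightarrow> real \<Rightarrow> bool" where
  "mirror_assumption1 N X chi \<psi>s L_chi \<longleftrightarrow>
     convex_on UNIV \<psi>s \<and> (\<forall>\<zeta>. \<psi>s differentiable (at \<zeta>)) \<and> (\<forall>\<zeta>. chi \<zeta> = grad \<psi>s \<zeta>) \<and>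
     (\<forall>\<zeta>. chi \<zeta> \<in> X) \<and>
     (\<forall>\<xi> \<zeta>. N (chi \<xi> - chi \<zeta>) \<le> L_chi * dual_norm N (\<xi> - \<zeta>))"

definition mirror_assumption2 ::
    "'a::euclidean_space set \<Rightarrow> ('a \<Rightarrow> 'a) \<Rightarrow> ('a \<Rightarrow> real) \<Rightarrow> ('a \<Rightarrow> ereal) \<Rightarrow> bool" where
  "mirror_assumption2 X chi \<psi>s \<phi> \<longleftrightarrow>
     (\<forall>\<zeta>. chi \<zeta> = grad \<psi>s \<zeta>) \<and> (\<forall>\<zeta>. chi differentiable (at \<zeta>)) \<and> range chi = rel_interior X \<and>
     (\<forall>\<zeta>. ereal (\<psi>s \<zeta>) = convex_conjugate (\<lambda>x. \<phi> x + set_indicator X x) \<zeta>) \<and>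
     ereal_proper \<phi> \<and> ereal_convex \<phi> \<and>
     (\<forall>z\<in>rel_interior X. ereal_differentiable_at \<phi> z) \<and> X \<subseteq> eff_dom \<phi>"

text \<open>Used for \<open>x \<in> X\<close> and \<open>z \<in> rel_interior X\<close> with \<open>X \<subseteq> eff_dom \<phi>\<close>, where \<open>\<phi>\<close> is finite.\<close>

definition bregman :: "('a::real_inner \<Rightarrow> ereal) \<Rightarrow> 'a \<Rightarrow> 'a \<Rightarrow> real" where
  "bregman \<phi> x z =
     real_of_ereal (\<phi> x) - real_of_ereal (\<phi> z) - ereal_grad \<phi> z \<bullet> (x - z)"

definition AMDR ::
    "'a::real_inner set \<Rightarrow> ('a \<Rightarrow> real) \<Rightarrow> ('a \<Rightarrow> 'a) \<Rightarrow> ('a \<Rightarrow> 'a \<Rightarrow> real) \<Rightarrow> real \<Rightarrow> real \<Rightarrow> real \<Rightarrow>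
     (nat \<Rightarrow> 'a) \<Rightarrow> (nat \<Rightarrow> 'a) \<Rightarrow> (nat \<Rightarrow> 'a) \<Rightarrow> bool" where
  "AMDR X f chi R h r \<gamma> x y \<zeta> \<longleftrightarrow>
     x 0 \<in> X \<and> chi (\<zeta> 0) = x 0 \<and>
     (\<forall>k. y k = x k + (r / (r + real k)) *\<^sub>R (chi (\<zeta> k) - x k) \<and>
          \<zeta> (Suc k) = \<zeta> k - (real k * h / r) *\<^sub>R grad f (y k) \<and>
          is_arg_min (\<lambda>u. \<gamma> * h * (grad f (y k) \<bullet> u) + R u (y k)) (\<lambda>u. u \<in> X) (x (Suc k)))"

definition V_hat ::
    "('a::real_inner \<Rightarrow> real) \<Rightarrow> ('a \<Rightarrow> ereal) \<Rightarrow> ('a \<Rightarrow> 'a) \<Rightarrow> real \<Rightarrow> 'a \<Rightarrow> 'a \<Rightarrow> 'a \<Rightarrow> real \<Rightarrow> real" where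
  "V_hat f \<phi> chi r xstar x \<zeta> t =
     t\<^sup>2 / r\<^sup>2 * (f x - f xstar) + bregman \<phi> xstar (chi \<zeta>)"

end

theory Submission
  imports Defs
begin

text \<open>
  Write \<open>z = chi (\<zeta> k)\<close>, \<open>z' = chi (\<zeta> (k + 1))\<close> and \<open>g = grad f (y k)\<close>. The change of the Lyapunov function
  is the sum of a dual and a primal part, and the strategy is to find the same two quantities
  \<open>g \<bullet> (xstar - z')\<close> and \<open>(N (z - z'))\<^sup>2\<close> in both, with opposite signs.

  Dual part. The Bregman divergence of \<open>\<phi>\<close> is defined through \<open>\<nabla>\<phi>\<close>, but at points of the form
  \<open>chi \<zeta>\<close> it equals \<open>\<phi> xstar + \<psi>s \<zeta> - \<zeta> \<bullet> xstar\<close> (\<open>bregman_mirror_eq_conjugate\<close>): although \<open>\<zeta>\<close> and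
  \<open>\<nabla>\<phi> (chi \<zeta>)\<close> may differ, their difference is orthogonal to all directions within \<open>X\<close>, because
  \<open>chi \<zeta>\<close> is a relative interior point at which \<open>\<phi> - \<zeta>\<close> is minimal over \<open>X\<close>. Thus only \<open>\<psi>s\<close> has to be
  tracked. Since \<open>chi = \<nabla>\<psi>s\<close> is Lipschitz with a constant \<open>L\<close>, \<open>\<psi>s\<close> satisfies the sharpened tangent
  inequality with the extra term \<open>(N (z - z'))\<^sup>2 / (2 * L)\<close> (\<open>convex_cocoercive\<close>). Hence the divergence
  grows by at most \<open>(k * h / r) * (g \<bullet> (xstar - z')) - (N (z - z'))\<^sup>2 / (2 * L)\<close>.

  Primal part. The point obtained from \<open>y k\<close> by replacing \<open>z\<close> with \<open>z'\<close>, that is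
  \<open>x k + r / (r + k) * (z' - x k)\<close>, lies in \<open>X\<close>, so it competes in the minimization that defines
  \<open>x (k + 1)\<close>. Together with the smoothness of \<open>f\<close> and the bounds on \<open>R\<close> this bounds
  \<open>f (x (k + 1)) - f (y k)\<close> by a multiple of \<open>g \<bullet> (z' - z)\<close> plus a multiple of \<open>(N (z - z'))\<^sup>2\<close>. The tangent of \<open>f\<close> at \<open>y k\<close>,
  compared with \<open>f\<close> at \<open>x k\<close> and at \<open>xstar\<close> with the weights \<open>k\<close> and \<open>r\<close> for which \<open>y k\<close> is the mean of \<open>x k\<close> and \<open>z\<close>, turns
  this into a bound on the objective gap (\<open>mirror_step_estimate\<close>).

  Adding both parts, the linear terms cancel exactly. Because of \<open>\<gamma> \<ge> L_R * L_chi\<close> one can choose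
  \<open>L = \<gamma> / L_R\<close>, and then the primal quadratic term is \<open>k / (k + r)\<close> times the dual one, which absorbs it.
\<close>

section \<open>Tangents of convex functions\<close>

lemma one_sided_slope_bound:
  fixes f :: "'a::real_inner \<Rightarrow> real"
  assumes D: "GDERIV f z :> D"
    and bd: "\<And>t. 0 < t \<Longrightarrow> t < 1 \<Longrightarrow> f (z + t *\<^sub>R v) - f z \<le> c * t"
  shows "D \<bullet> v \<le> c"
proof -
  have d: "((\<lambda>t. f (z + t *\<^sub>R v)) has_derivative (\<lambda>t. (t *\<^sub>R v) \<bullet> D)) (at 0)"
  proof (rule has_derivative_compose[where g = f and f = "\<lambda>t. z + t *\<^sub>R v"])
    show "((\<lambda>t. z + t *\<^sub>R v) has_derivative (\<lambda>t. t *\<^sub>R v)) (at 0)"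
      by (auto intro!: derivative_eq_intros)
    show "(f has_derivative (\<lambda>h. h \<bullet> D)) (at (z + 0 *\<^sub>R v))"
      using D by (simp add: gderiv_def)
  qed
  have "((\<lambda>t. f (z + t *\<^sub>R v)) has_real_derivative D \<bullet> v) (at 0)"
    unfolding has_field_derivative_def
    by (rule has_derivative_eq_rhs[OF d]) (auto simp: fun_eq_iff inner_commute)
  then have "((\<lambda>t. (f (z + t *\<^sub>R v) - f z) / t) \<longlongrightarrow> D \<bullet> v) (at 0)"
    by (simp add: DERIV_def)
  then have "((\<lambda>t. (f (z + t *\<^sub>R v) - f z) / t) \<longlongrightarrow> D \<bullet> v) (at_right 0)"
    by (rule filterlim_mono[OF _ order_refl at_le]) simp
  moreover have "\<forall>\<^sub>F t in at_right 0. (f (z + t *\<^sub>R v) - f z) / t \<le> c"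
    unfolding eventually_at_right_field
    by (rule exI[of _ 1]) (auto simp: pos_divide_le_eq bd)
  ultimately show ?thesis
    by (rule tendsto_upperbound) simp
qed

text \<open>
  The gradient is taken in the full space while convexity is only known on \<open>S\<close>, and \<open>z\<close> may be
  a boundary point of \<open>S\<close>. The one-sided slope towards \<open>x\<close> suffices.
\<close>

lemma convex_on_above_gradient_tangent:
  fixes f :: "'a::real_inner \<Rightarrow> real"
  assumes "convex_on S f" "z \<in> S" "x \<in> S" "GDERIV f z :> D"
  shows "f z + D \<bullet> (x - z) \<le> f x"
proof -
  have "D \<bullet> (x - z) \<le> f x - f z"
  proof (rule one_sided_slope_bound[OF assms(4)])
    fix t :: real assume t: "0 < t" "t < 1"
    have "f (z + t *\<^sub>R (x - z)) = f ((1 - t) *\<^sub>R z + t *\<^sub>R x)"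
      by (simp add: algebra_simps)
    also have "\<dots> \<le> (1 - t) * f z + t * f x"
      using assms(1-3) t by (intro convex_onD) auto
    finally show "f (z + t *\<^sub>R (x - z)) - f z \<le> (f x - f z) * t"
      by (simp add: algebra_simps)
  qed
  then show ?thesis by simp
qed

text \<open>
  First-order optimality of \<open>z\<close> for \<open>f - \<zeta>\<close> gives the inequality \<open>\<ge>\<close> in every direction into \<open>X\<close>. At a
  relative interior point the segment from \<open>x\<close> can be prolonged beyond \<open>z\<close> within \<open>X\<close>, so the opposite
  direction is admissible too.
\<close>

lemma GDERIV_orthogonal_of_rel_interior_minorant:
  fixes f :: "'a::euclidean_space \<Rightarrow> real"
  assumes X: "convex X" and z: "z \<in> rel_interior X" and x: "x \<in> X"
    and D: "GDERIV f z :> D"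
    and minorant: "\<And>u. u \<in> X \<Longrightarrow> f z + \<zeta> \<bullet> (u - z) \<le> f u"
  shows "D \<bullet> (x - z) = \<zeta> \<bullet> (x - z)"
proof -
  have ge: "\<zeta> \<bullet> (u - z) \<le> D \<bullet> (u - z)" if u: "u \<in> X" for u
  proof -
    have "GDERIV (\<lambda>x. - f x) z :> - D"
      using D by (rule GDERIV_minus)
    then have "(- D) \<bullet> (u - z) \<le> - (\<zeta> \<bullet> (u - z))"
    proof (rule one_sided_slope_bound)
      fix t :: real assume t: "0 < t" "t < 1"
      have "(1 - t) *\<^sub>R z + t *\<^sub>R u \<in> X"
        using X z u t rel_interior_subset by (intro convexD) auto
      then have "z + t *\<^sub>R (u - z) \<in> X"
        by (simp add: algebra_simps)
      from minorant[OF this]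
      show "- f (z + t *\<^sub>R (u - z)) - - f z \<le> - (\<zeta> \<bullet> (u - z)) * t"
        by (simp add: mult.commute)
    qed
    then show ?thesis by simp
  qed
  obtain m where m: "m > 1" "(1 - m) *\<^sub>R x + m *\<^sub>R z \<in> X"
    using convex_rel_interior_if[OF X z] x hull_inc[of x X] by (meson order_refl)
  have "(1 - m) *\<^sub>R x + m *\<^sub>R z - z = (1 - m) *\<^sub>R (x - z)"
    by (simp add: algebra_simps)
  with ge[OF m(2)] have "(1 - m) * (\<zeta> \<bullet> (x - z)) \<le> (1 - m) * (D \<bullet> (x - z))"
    by simp
  then have "D \<bullet> (x - z) \<le> \<zeta> \<bullet> (x - z)"
    using m(1) by (simp add: mult_le_cancel_left)
  with ge[OF x] show ?thesis by simp
qed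

section \<open>Dual norms\<close>

lemma is_norm_zero: "is_norm N \<Longrightarrow> N 0 = 0"
  by (simp add: is_norm_def)

text \<open>
  All norms in finite dimension are equivalent. This half of the equivalence makes the supremum in
  \<open>dual_norm\<close> finite; it comes from the minimum of \<open>N\<close> on the compact Euclidean sphere.
\<close>

lemma is_norm_bounded_below:
  fixes N :: "'a::euclidean_space \<Rightarrow> real"
  assumes N: "is_norm N"
  obtains c where "c > 0" "\<And>x. c * norm x \<le> N x"
proof -
  have N0: "N x \<ge> 0" "N x = 0 \<longleftrightarrow> x = 0" "N (a *\<^sub>R x) = \<bar>a\<bar> * N x" "N (x + y) \<le> N x + N y"
    for x y a using N by (auto simp: is_norm_def)
  have conv: "convex_on UNIV N"
  proof (rule convex_onI)
    fix t :: real and x y :: 'a assume t: "0 < t" "t < 1"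
    show "N ((1 - t) *\<^sub>R x + t *\<^sub>R y) \<le> (1 - t) * N x + t * N y"
      using N0(4)[of "(1 - t) *\<^sub>R x" "t *\<^sub>R y"] t by (simp add: N0(3))
  qed simp
  have cont: "continuous_on (sphere 0 1) N"
    by (rule continuous_on_subset[OF convex_on_continuous[OF open_UNIV conv]]) simp
  have "sphere (0::'a) 1 \<noteq> {}" by simp
  then obtain u where u: "u \<in> sphere 0 1" "\<And>x. x \<in> sphere 0 1 \<Longrightarrow> N u \<le> N x"
    using continuous_attains_inf[OF compact_sphere _ cont] by blast
  show thesis
  proof
    have "u \<noteq> 0" using u(1) by auto
    then show "N u > 0" using N0(1)[of u] N0(2)[of u] by linarith
    fix x :: 'a
    show "N u * norm x \<le> N x"
    proof (cases "x = 0")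
      case False
      then have "N u \<le> N ((1 / norm x) *\<^sub>R x)" by (intro u(2)) simp
      then show ?thesis using False by (simp add: N0(3) field_simps)
    qed (use N0 in auto)
  qed
qed

lemma dual_norm_le:
  assumes N: "is_norm N" and bd: "\<And>x. N x \<le> 1 \<Longrightarrow> w \<bullet> x \<le> c"
  shows "dual_norm N w \<le> c"
proof -
  have "N 0 \<le> 1" using N by (simp add: is_norm_zero)
  then show ?thesis
    unfolding dual_norm_def by (intro cSup_least) (auto intro: bd)
qed

lemma dual_norm_upper:
  fixes N :: "'a::euclidean_space \<Rightarrow> real"
  assumes N: "is_norm N" and x: "N x \<le> 1"
  shows "w \<bullet> x \<le> dual_norm N w"
proof -
  obtain c where c: "c > 0" "\<And>x. c * norm x \<le> N x"
    using is_norm_bounded_below[OF N] by blast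
  have "w \<bullet> u \<le> norm w * (1 / c)" if "N u \<le> 1" for u
  proof -
    have "norm u \<le> 1 / c"
      using c(2)[of u] c(1) that by (simp add: field_simps)
    then show ?thesis
      using norm_cauchy_schwarz[of w u] mult_left_mono[of "norm u" "1 / c" "norm w"] by simp
  qed
  then have "bdd_above {w \<bullet> u | u. N u \<le> 1}"
    by (auto simp: bdd_above_def)
  then show ?thesis
    unfolding dual_norm_def using x by (intro cSup_upper) auto
qed

lemma dual_norm_nonneg:
  fixes N :: "'a::euclidean_space \<Rightarrow> real"
  assumes "is_norm N"
  shows "0 \<le> dual_norm N w"
  using dual_norm_upper[OF assms, of 0 w] assms by (simp add: is_norm_zero)

lemma inner_le_dual_norm:
  fixes N :: "'a::euclidean_space \<Rightarrow> real"
  assumes N: "is_norm N"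
  shows "w \<bullet> x \<le> dual_norm N w * N x"
proof (cases "x = 0")
  case True
  then show ?thesis using N by (simp add: is_norm_zero)
next
  case False
  then have pos: "N x > 0" using N by (auto simp: is_norm_def less_le)
  then have "N ((1 / N x) *\<^sub>R x) = 1"
    using N False by (simp add: is_norm_def)
  then have "w \<bullet> ((1 / N x) *\<^sub>R x) \<le> dual_norm N w"
    by (intro dual_norm_upper[OF N]) simp
  then show ?thesis using pos by (simp add: field_simps)
qed

text \<open>
  The Hahn-Banach theorem, obtained by separating \<open>v\<close> from the open ball of radius \<open>N v\<close> and rescaling
  the separating functional. It represents \<open>N v\<close> as a pairing, which is how the arbitrary norm enters
  arguments that for the Euclidean norm would use \<open>v\<close> itself as test vector.
\<close>

lemma norming_functional:
  fixes N :: "'a::euclidean_space \<Rightarrow> real"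
  assumes N: "is_norm N"
  obtains w where "w \<bullet> v = N v" "\<And>x. w \<bullet> x \<le> N x"
proof (cases "v = 0")
  case True
  then show thesis using N that[of 0] by (simp add: is_norm_def)
next
  case False
  have N0: "N x \<ge> 0" "N x = 0 \<longleftrightarrow> x = 0" "N (a *\<^sub>R x) = \<bar>a\<bar> * N x" "N (x + y) \<le> N x + N y"
    for x y a using N by (auto simp: is_norm_def)
  have v: "N v > 0" using False N0(1)[of v] N0(2)[of v] by linarith
  define B where "B = {x. N x < N v}"
  have "convex B"
  proof (rule convexI)
    fix x y and a b :: real
    assume xy: "x \<in> B" "y \<in> B" and ab: "0 \<le> a" "0 \<le> b" "a + b = 1"
    have "N (a *\<^sub>R x + b *\<^sub>R y) \<le> a * N x + b * N y"
      using N0(4)[of "a *\<^sub>R x" "b *\<^sub>R y"] ab by (simp add: N0(3))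
    also have "\<dots> < N v"
      using xy ab by (intro convex_bound_lt) (auto simp: B_def)
    finally show "a *\<^sub>R x + b *\<^sub>R y \<in> B" by (simp add: B_def)
  qed
  moreover have "0 \<in> B" using v N0(2)[of 0] by (simp add: B_def)
  moreover have "B \<inter> {v} = {}" by (auto simp: B_def)
  ultimately obtain a b where a: "a \<noteq> 0" "\<And>x. x \<in> B \<Longrightarrow> a \<bullet> x \<le> b" "b \<le> a \<bullet> v"
    using separating_hyperplane_sets[of B "{v}"] by auto
  \<comment> \<open>Scaling \<open>x\<close> by \<open>N v / N x\<close> would land on the boundary of the ball, and may divide by zero; hence the
    slightly larger denominator \<open>m\<close>, whose excess costs at most \<open>e\<close>.\<close>
  have key: "N v * (a \<bullet> x) \<le> (a \<bullet> v) * N x" for x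
  proof (rule field_le_epsilon)
    fix e :: real assume e: "e > 0"
    have bv: "0 \<le> a \<bullet> v" using a(2)[OF \<open>0 \<in> B\<close>] a(3) by simp
    define m where "m = N x + e / (a \<bullet> v + 1)"
    have m: "m > N x" "m > 0" using e bv N0(1)[of x] by (auto simp: m_def intro: add_nonneg_pos)
    have "N ((N v / m) *\<^sub>R x) = N v * (N x / m)" using m v by (simp add: N0(3))
    also have "\<dots> < N v" using m v by (simp add: field_simps)
    finally have "a \<bullet> ((N v / m) *\<^sub>R x) \<le> a \<bullet> v"
      using a(2)[of "(N v / m) *\<^sub>R x"] a(3) by (simp add: B_def)
    then have "N v * (a \<bullet> x) \<le> (a \<bullet> v) * m" using m by (simp add: field_simps)
    also have "\<dots> = (a \<bullet> v) * N x + (a \<bullet> v) * e / (a \<bullet> v + 1)"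
      by (simp add: m_def algebra_simps)
    also have "\<dots> \<le> (a \<bullet> v) * N x + e"
      using bv e by (simp add: field_simps)
    finally show "N v * (a \<bullet> x) \<le> (a \<bullet> v) * N x + e" .
  qed
  have av: "a \<bullet> v > 0"
  proof (rule ccontr)
    assume "\<not> a \<bullet> v > 0"
    then have "(a \<bullet> v) * N a \<le> 0" using N0(1)[of a] by (simp add: mult_nonpos_nonneg)
    with key[of a] have "N v * (a \<bullet> a) \<le> 0" by simp
    moreover have "N v * (a \<bullet> a) > 0" using v a(1) by simp
    ultimately show False by simp
  qed
  show thesis
  proof
    show "((N v / (a \<bullet> v)) *\<^sub>R a) \<bullet> v = N v" using av by simp
    show "((N v / (a \<bullet> v)) *\<^sub>R a) \<bullet> x \<le> N x" for x
      using key[of x] av by (simp add: field_simps)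
  qed
qed

section \<open>Smooth convex functions on the dual space\<close>

text \<open>
  From \<open>\<zeta>\<close>, move against a functional \<open>w\<close> of dual norm at most 1 that norms \<open>chi \<zeta> - chi \<zeta>'\<close>, for a
  time \<open>\<tau>\<close>. The Lipschitz gradient bounds \<open>\<psi>s\<close> from above at the resulting point, and the
  tangent at \<open>\<zeta>'\<close> bounds it from below there. Comparing the two bounds gives an inequality quadratic
  in \<open>\<tau>\<close>, which is sharpest for \<open>\<tau> = N (chi \<zeta> - chi \<zeta>') / L\<close>.
\<close>

lemma convex_cocoercive:
  fixes \<psi>s :: "'a::euclidean_space \<Rightarrow> real"
  assumes N: "is_norm N" and L: "L > 0"
    and conv: "convex_on UNIV \<psi>s"
    and G: "\<And>\<zeta>. GDERIV \<psi>s \<zeta> :> chi \<zeta>"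
    and Lip: "\<And>\<xi> \<zeta>. N (chi \<xi> - chi \<zeta>) \<le> L * dual_norm N (\<xi> - \<zeta>)"
  shows "\<psi>s \<zeta>' + chi \<zeta>' \<bullet> (\<zeta> - \<zeta>') + (N (chi \<zeta> - chi \<zeta>'))\<^sup>2 / (2 * L) \<le> \<psi>s \<zeta>"
proof -
  define e where "e = N (chi \<zeta> - chi \<zeta>')"
  obtain w where w: "w \<bullet> (chi \<zeta> - chi \<zeta>') = e" "\<And>x. w \<bullet> x \<le> N x"
    using norming_functional[OF N, of "chi \<zeta> - chi \<zeta>'"] unfolding e_def by blast
  define \<tau> where "\<tau> = e / L"
  have \<tau>: "\<tau> \<ge> 0" using N L by (simp add: \<tau>_def e_def is_norm_def)
  define q where "q t = \<psi>s (\<zeta> - t *\<^sub>R w) + t * (chi \<zeta> \<bullet> w) - L / 2 * t\<^sup>2" for t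
  \<comment> \<open>The descent lemma along \<open>w\<close>, with the sharp factor 1/2.\<close>
  have "q \<tau> \<le> q 0"
  proof (rule DERIV_nonpos_imp_nonincreasing[OF \<tau>])
    fix t assume t: "0 \<le> t" "t \<le> \<tau>"
    have "((\<lambda>t. \<zeta> - t *\<^sub>R w) has_derivative (\<lambda>s. - (s *\<^sub>R w))) (at t)"
      by (auto intro!: derivative_eq_intros)
    from has_derivative_compose[OF this G[of "\<zeta> - t *\<^sub>R w", unfolded gderiv_def]]
    have "((\<lambda>t. \<psi>s (\<zeta> - t *\<^sub>R w)) has_real_derivative - (w \<bullet> chi (\<zeta> - t *\<^sub>R w))) (at t)"
      unfolding has_field_derivative_def
      by (rule has_derivative_eq_rhs) (auto simp: fun_eq_iff)
    then have "(q has_real_derivative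
        - (w \<bullet> chi (\<zeta> - t *\<^sub>R w)) + chi \<zeta> \<bullet> w - L * t) (at t)"
      unfolding q_def by (auto intro!: derivative_eq_intros)
    moreover have "- (w \<bullet> chi (\<zeta> - t *\<^sub>R w)) + chi \<zeta> \<bullet> w - L * t \<le> 0"
    proof -
      have "w \<bullet> (chi \<zeta> - chi (\<zeta> - t *\<^sub>R w)) \<le> N (chi \<zeta> - chi (\<zeta> - t *\<^sub>R w))"
        by (rule w(2))
      also have "\<dots> \<le> L * dual_norm N (t *\<^sub>R w)"
        using Lip[of \<zeta> "\<zeta> - t *\<^sub>R w"] by simp
      also have "dual_norm N (t *\<^sub>R w) \<le> t"
      proof (rule dual_norm_le[OF N])
        fix x assume "N x \<le> 1"
        then have "w \<bullet> x \<le> 1" using w(2)[of x] by simp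
        then show "(t *\<^sub>R w) \<bullet> x \<le> t" using t mult_left_mono[of "w \<bullet> x" 1 t] by simp
      qed
      finally show ?thesis using L by (simp add: inner_diff_right inner_commute)
    qed
    ultimately show "\<exists>y. DERIV q t :> y \<and> y \<le> 0" by blast
  qed
  moreover have "\<psi>s \<zeta>' + chi \<zeta>' \<bullet> (\<zeta> - \<tau> *\<^sub>R w - \<zeta>') \<le> \<psi>s (\<zeta> - \<tau> *\<^sub>R w)"
    by (rule convex_on_above_gradient_tangent[OF conv _ _ G]) auto
  ultimately have "\<psi>s \<zeta>' + chi \<zeta>' \<bullet> (\<zeta> - \<zeta>') + (\<tau> * (w \<bullet> (chi \<zeta> - chi \<zeta>')) - L / 2 * \<tau>\<^sup>2) \<le> \<psi>s \<zeta>"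
    by (simp add: q_def inner_diff_right inner_diff_left inner_commute algebra_simps)
  moreover have "\<tau> * e - L / 2 * \<tau>\<^sup>2 = e\<^sup>2 / (2 * L)"
    using L by (simp add: \<tau>_def power2_eq_square field_simps)
  ultimately show ?thesis by (simp add: w(1) e_def)
qed

section \<open>The Bregman divergence in dual variables\<close>

text \<open>
  The essential step is equality in Fenchel's inequality at \<open>z = chi \<zeta>\<close>. It is found without
  biconjugation: \<open>\<phi>\<close> has a gradient \<open>\<eta>\<close> at \<open>z\<close>, so equality holds for the pair \<open>\<eta>, z\<close>, and the tangent
  of \<open>\<psi>s\<close> at \<open>\<zeta>\<close>, whose slope is \<open>z\<close>, carries it from \<open>\<eta>\<close> to \<open>\<zeta>\<close>. Equality says that \<open>z\<close> minimizes
  \<open>\<phi> - \<zeta>\<close> over \<open>X\<close>, hence \<open>\<eta>\<close> and \<open>\<zeta>\<close> agree along \<open>X\<close> and \<open>\<eta>\<close> can be replaced by \<open>\<zeta>\<close> in the divergence.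
\<close>

lemma bregman_mirror_eq_conjugate:
  fixes X :: "'a::euclidean_space set"
  assumes X: "convex X" "xs \<in> X"
    and conv: "convex_on UNIV \<psi>s"
    and G: "\<And>\<zeta>. GDERIV \<psi>s \<zeta> :> chi \<zeta>"
    and A2: "mirror_assumption2 X chi \<psi>s \<phi>"
  shows "bregman \<phi> xs (chi \<zeta>) = real_of_ereal (\<phi> xs) + \<psi>s \<zeta> - \<zeta> \<bullet> xs"
proof -
  define p where "p u = real_of_ereal (\<phi> u)" for u
  define z where "z = chi \<zeta>"
  define \<eta> where "\<eta> = ereal_grad \<phi> z"
  have conj: "ereal (\<psi>s \<xi>) = convex_conjugate (\<lambda>x. \<phi> x + set_indicator X x) \<xi>" for \<xi>
    using A2 by (simp add: mirror_assumption2_def)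
  have proper: "\<phi> u \<noteq> -\<infinity>" for u
    using A2 by (simp add: mirror_assumption2_def ereal_proper_def)
  have fin: "\<phi> u = ereal (p u)" if "u \<in> X" for u
    using A2 that proper[of u]
    by (auto simp: mirror_assumption2_def eff_dom_def p_def ereal_real)
  have z: "z \<in> rel_interior X"
    using A2 by (auto simp: mirror_assumption2_def z_def)
  then have zX: "z \<in> X" using rel_interior_subset by blast
  have "p differentiable (at z)"
    using A2 z by (auto simp: mirror_assumption2_def ereal_differentiable_at_def p_def[abs_def])
  then have D: "GDERIV p z :> \<eta>"
    using GDERIV_grad unfolding \<eta>_def ereal_grad_def p_def[abs_def] by blast
  have convp: "convex_on X p"
  proof (rule convex_onI)
    fix t :: real and u v assume t: "0 < t" "t < 1" and uv: "u \<in> X" "v \<in> X"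
    have mem: "(1 - t) *\<^sub>R u + t *\<^sub>R v \<in> X"
      using X(1) t uv by (intro convexD) auto
    have "\<forall>x y. \<forall>u::real. 0 < u \<and> u < 1 \<longrightarrow>
        \<phi> (u *\<^sub>R x + (1 - u) *\<^sub>R y) \<le> ereal u * \<phi> x + ereal (1 - u) * \<phi> y"
      using A2 by (simp add: mirror_assumption2_def ereal_convex_def)
    from this[rule_format, of "1 - t" u v]
    have "\<phi> ((1 - t) *\<^sub>R u + t *\<^sub>R v) \<le> ereal (1 - t) * \<phi> u + ereal t * \<phi> v"
      using t by simp
    then show "p ((1 - t) *\<^sub>R u + t *\<^sub>R v) \<le> (1 - t) * p u + t * p v"
      using fin[OF mem] fin uv by simp
  qed (rule X)
  have young: "\<xi> \<bullet> u - p u \<le> \<psi>s \<xi>" if "u \<in> X" for \<xi> u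
  proof -
    have "ereal (\<xi> \<bullet> u) - (\<phi> u + set_indicator X u) \<le> ereal (\<psi>s \<xi>)"
      unfolding conj convex_conjugate_def by (rule SUP_upper) simp
    then show ?thesis using that fin by (simp add: set_indicator_def)
  qed
  have "\<psi>s \<eta> \<le> \<eta> \<bullet> z - p z"
  proof -
    have "ereal (\<eta> \<bullet> u) - (\<phi> u + set_indicator X u) \<le> ereal (\<eta> \<bullet> z - p z)" for u
    proof (cases "u \<in> X")
      case True
      have "p z + \<eta> \<bullet> (u - z) \<le> p u"
        by (rule convex_on_above_gradient_tangent[OF convp zX True D])
      then show ?thesis using True fin by (simp add: set_indicator_def inner_diff_right)
    next
      case False
      then show ?thesis by (simp add: set_indicator_def)
    qed
    then have "ereal (\<psi>s \<eta>) \<le> ereal (\<eta> \<bullet> z - p z)"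
      unfolding conj convex_conjugate_def by (intro SUP_least) auto
    then show ?thesis by simp
  qed
  moreover have "\<psi>s \<zeta> + z \<bullet> (\<eta> - \<zeta>) \<le> \<psi>s \<eta>"
    unfolding z_def by (rule convex_on_above_gradient_tangent[OF conv _ _ G]) auto
  ultimately have eq: "\<psi>s \<zeta> = \<zeta> \<bullet> z - p z"
    using young[OF zX, of \<zeta>] by (simp add: inner_diff_right inner_commute)
  have "\<eta> \<bullet> (xs - z) = \<zeta> \<bullet> (xs - z)"
  proof (rule GDERIV_orthogonal_of_rel_interior_minorant[OF X(1) z X(2) D])
    show "p z + \<zeta> \<bullet> (u - z) \<le> p u" if "u \<in> X" for u
      using young[OF that, of \<zeta>] eq by (simp add: inner_diff_right)
  qed
  then show ?thesis
    using eq by (simp add: bregman_def p_def z_def \<eta>_def inner_diff_right)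
qed

section \<open>One step of the method\<close>

text \<open>
  The primal half of the argument, with \<open>\<kappa>\<close> for the iteration counter and \<open>\<eta>\<close> for \<open>\<gamma> * h\<close>. Here \<open>z'\<close> can be
  any point of \<open>X\<close>: the competitor \<open>u\<close> satisfies \<open>u - y = c *\<^sub>R (z' - z)\<close>, which is what lets the minimality
  of \<open>x'\<close> produce \<open>g \<bullet> (z' - z)\<close>.
\<close>

lemma mirror_step_estimate:
  fixes X :: "'a::euclidean_space set"
  assumes N: "is_norm N" and X: "convex X"
    and U: "X \<subseteq> U" and f: "convex_on U f" and G: "\<And>u. u \<in> U \<Longrightarrow> GDERIV f u :> grad f u"
    and smooth: "\<And>u v. u \<in> U \<Longrightarrow> v \<in> U \<Longrightarrow> dual_norm N (grad f u - grad f v) \<le> L_f * N (u - v)"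
    and R: "\<And>u v. u \<in> X \<Longrightarrow> v \<in> X \<Longrightarrow> l_R / 2 * (N (u - v))\<^sup>2 \<le> R u v"
      "\<And>u v. u \<in> X \<Longrightarrow> v \<in> X \<Longrightarrow> R u v \<le> L_R / 2 * (N (u - v))\<^sup>2"
    and pos: "\<eta> > 0" "r > 0" "\<kappa> \<ge> 0"
    and step: "2 * L_f * \<eta> \<le> l_R"
    and mem: "x \<in> X" "z \<in> X" "z' \<in> X" "xs \<in> X"
    and y: "y = x + (r / (r + \<kappa>)) *\<^sub>R (z - x)"
    and x': "is_arg_min (\<lambda>u. \<eta> * (grad f y \<bullet> u) + R u y) (\<lambda>u. u \<in> X) x'"
  shows "(\<kappa> + r) * (f x' - f xs) - \<kappa> * (f x - f xs) + r * (grad f y \<bullet> (xs - z'))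
    \<le> r\<^sup>2 * L_R / (2 * \<eta> * (\<kappa> + r)) * (N (z - z'))\<^sup>2"
proof -
  define c where "c = r / (r + \<kappa>)"
  define g where "g = grad f y"
  have c: "0 \<le> c" "c \<le> 1" and cr: "(\<kappa> + r) * c = r" using pos by (auto simp: c_def field_simps)
  have comb: "x + c *\<^sub>R (u - x) \<in> X" if "u \<in> X" for u
  proof -
    have "(1 - c) *\<^sub>R x + c *\<^sub>R u \<in> X" using X mem(1) that c by (intro convexD) auto
    then show ?thesis by (simp add: algebra_simps)
  qed
  have yX: "y \<in> X" using comb[OF mem(2)] by (simp add: y c_def)
  have x'X: "x' \<in> X" using x' by (simp add: is_arg_min_def)
  define u where "u = x + c *\<^sub>R (z' - x)"
  have uX: "u \<in> X" unfolding u_def by (rule comb[OF mem(3)])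
  have uy: "u - y = c *\<^sub>R (z' - z)" unfolding u_def y c_def[symmetric] by (simp add: algebra_simps)
  have Nuy: "N (u - y) = c * N (z - z')"
  proof -
    have "u - y = (- c) *\<^sub>R (z - z')" by (simp add: uy algebra_simps)
    then show ?thesis using N c unfolding is_norm_def by (metis abs_minus_cancel abs_of_nonneg)
  qed
  have "\<eta> * (g \<bullet> x') + R x' y \<le> \<eta> * (g \<bullet> u) + R u y"
    using x' uX unfolding g_def is_arg_min_def by (meson not_le)
  then have opt: "\<eta> * (g \<bullet> (x' - y)) + l_R / 2 * (N (x' - y))\<^sup>2
      \<le> \<eta> * (g \<bullet> (u - y)) + L_R / 2 * (N (u - y))\<^sup>2"
    using R(1)[OF x'X yX] R(2)[OF uX yX] by (simp add: inner_diff_right algebra_simps)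
  have tang: "f a + grad f a \<bullet> (b - a) \<le> f b" if "a \<in> X" "b \<in> X" for a b
    by (rule convex_on_above_gradient_tangent[OF f _ _ G]) (use that U in auto)
  \<comment> \<open>The tangent at \<open>x'\<close> instead of an integral along the segment gives \<open>L_f\<close> in place of \<open>L_f / 2\<close>;
    the factor 2 in the step size condition pays for the loss.\<close>
  have "f x' - f y \<le> g \<bullet> (x' - y) + L_f * (N (x' - y))\<^sup>2"
  proof -
    have "f x' - f y \<le> grad f x' \<bullet> (x' - y)"
      using tang[OF x'X yX] by (simp add: inner_diff_right)
    also have "\<dots> = g \<bullet> (x' - y) + (grad f x' - grad f y) \<bullet> (x' - y)"
      by (simp add: g_def inner_diff_left)
    also have "(grad f x' - grad f y) \<bullet> (x' - y) \<le> dual_norm N (grad f x' - grad f y) * N (x' - y)"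
      by (rule inner_le_dual_norm[OF N])
    also have "\<dots> \<le> L_f * N (x' - y) * N (x' - y)"
      using smooth[of x' y] x'X yX U N by (intro mult_right_mono) (auto simp: is_norm_def)
    finally show ?thesis by (simp add: power2_eq_square mult.assoc)
  qed
  then have "\<eta> * (f x' - f y) \<le> \<eta> * (g \<bullet> (x' - y) + L_f * (N (x' - y))\<^sup>2)"
    using pos by (intro mult_left_mono) auto
  also have "\<dots> \<le> \<eta> * (g \<bullet> (x' - y)) + l_R / 2 * (N (x' - y))\<^sup>2"
    using mult_right_mono[of "L_f * \<eta>" "l_R / 2" "(N (x' - y))\<^sup>2"] step
    by (simp add: algebra_simps)
  also note opt
  finally have "\<eta> * (f x' - f y) \<le> \<eta> * (c * (g \<bullet> (z' - z))) + L_R / 2 * (c * N (z - z'))\<^sup>2"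
    by (simp add: Nuy) (simp add: uy)
  then have "f x' - f y \<le> c * (g \<bullet> (z' - z)) + L_R * c\<^sup>2 / (2 * \<eta>) * (N (z - z'))\<^sup>2"
    using pos by (simp add: field_simps power_mult_distrib)
  then have "(\<kappa> + r) * (f x' - f y)
      \<le> (\<kappa> + r) * (c * (g \<bullet> (z' - z)) + L_R * c\<^sup>2 / (2 * \<eta>) * (N (z - z'))\<^sup>2)"
    using pos by (intro mult_left_mono) auto
  also have "\<dots> = ((\<kappa> + r) * c) * (g \<bullet> (z' - z))
      + L_R * (((\<kappa> + r) * c) * c) / (2 * \<eta>) * (N (z - z'))\<^sup>2"
    by (simp add: algebra_simps power2_eq_square add_divide_distrib)
  also have "\<dots> = r * (g \<bullet> (z' - z)) + r\<^sup>2 * L_R / (2 * \<eta> * (\<kappa> + r)) * (N (z - z'))\<^sup>2"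
    unfolding cr by (simp add: c_def power2_eq_square add.commute mult_ac)
  finally have progress: "(\<kappa> + r) * (f x' - f y)
      \<le> r * (g \<bullet> (z' - z)) + r\<^sup>2 * L_R / (2 * \<eta> * (\<kappa> + r)) * (N (z - z'))\<^sup>2" .
  \<comment> \<open>\<open>y\<close> is the mean of \<open>x\<close> and \<open>z\<close> with weights \<open>\<kappa>\<close> and \<open>r\<close>, so the points \<open>x\<close> and \<open>y\<close> drop out.\<close>
  have "\<kappa> * (f y - f x) + r * (f y - f xs) \<le> \<kappa> * (g \<bullet> (y - x)) + r * (g \<bullet> (y - xs))"
    using tang[OF yX mem(1)] tang[OF yX mem(4)] pos
    by (intro add_mono mult_left_mono) (auto simp: g_def inner_diff_right)
  also have "\<dots> = g \<bullet> ((\<kappa> + r) *\<^sub>R y - \<kappa> *\<^sub>R x - r *\<^sub>R xs)"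
    by (simp add: inner_diff_right algebra_simps)
  also have "(\<kappa> + r) *\<^sub>R y - \<kappa> *\<^sub>R x - r *\<^sub>R xs = r *\<^sub>R (z - xs)"
  proof -
    have "(\<kappa> + r) *\<^sub>R y = (\<kappa> + r) *\<^sub>R x + ((\<kappa> + r) * c) *\<^sub>R (z - x)"
      unfolding y c_def[symmetric] by (simp add: scaleR_right_distrib)
    then show ?thesis unfolding cr by (simp add: algebra_simps)
  qed
  finally have "\<kappa> * (f y - f x) + r * (f y - f xs) \<le> r * (g \<bullet> (z - xs))" by simp
  with progress show ?thesis
    unfolding g_def by (simp add: inner_diff_right algebra_simps)
qed

theorem theorem4:
  fixes N :: "real ^ 'n \<Rightarrow> real"
    and X U :: "(real ^ 'n) set"
    and f :: "real ^ 'n \<Rightarrow> real"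
    and chi :: "real ^ 'n \<Rightarrow> real ^ 'n"
    and \<psi>s :: "real ^ 'n \<Rightarrow> real"
    and \<phi> :: "real ^ 'n \<Rightarrow> ereal"
    and R :: "real ^ 'n \<Rightarrow> real ^ 'n \<Rightarrow> real"
    and x y \<zeta> :: "nat \<Rightarrow> real ^ 'n"
    and xstar :: "real ^ 'n"
    and h \<delta> r \<gamma> l_R L_R L_chi L_f :: real
    and k :: nat
  assumes "is_norm N"
    and "X \<noteq> {}" "closed X" "convex X"
    and "open U" "X \<subseteq> U" "convex_on U f"
    and "\<forall>u\<in>U. f differentiable (at u)" "continuous_on U (grad f)"
    and "mirror_assumption1 N X chi \<psi>s L_chi"
    and "mirror_assumption2 X chi \<psi>s \<phi>"
    and "h > 0" "r > 0" "\<gamma> > 0"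
    and "0 < l_R" "l_R \<le> L_R"
    and "\<forall>u\<in>X. \<forall>v\<in>X. l_R / 2 * (N (u - v))\<^sup>2 \<le> R u v \<and> R u v \<le> L_R / 2 * (N (u - v))\<^sup>2"
    and "AMDR X f chi R h r \<gamma> x y \<zeta>"
    and "is_arg_min f (\<lambda>u. u \<in> X) xstar"
    and "\<delta> = sqrt h"
    and "L_f > 0"
    and "\<forall>u\<in>U. \<forall>v\<in>U. dual_norm N (grad f u - grad f v) \<le> L_f * N (u - v)"
    and "\<gamma> \<ge> L_R * L_chi"
    and "h \<le> l_R / (2 * L_f * \<gamma>)"
  shows "V_hat f \<phi> chi r xstar (x (k + 1)) (\<zeta> (k + 1)) ((real k + 1) * \<delta>)
           - V_hat f \<phi> chi r xstar (x k) (\<zeta> k) (real k * \<delta>)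
         \<le> (2 * real k + 1 - real k * r) * h / r\<^sup>2 * (f (x (k + 1)) - f xstar)"
proof -
  have N: "is_norm N" and X: "convex X" by fact+
  have psi: "convex_on UNIV \<psi>s" "\<And>\<zeta>. \<psi>s differentiable (at \<zeta>)" "\<And>\<zeta>. chi \<zeta> = grad \<psi>s \<zeta>"
    and chiX: "\<And>\<zeta>. chi \<zeta> \<in> X"
    and Lip: "\<And>\<xi> \<zeta>. N (chi \<xi> - chi \<zeta>) \<le> L_chi * dual_norm N (\<xi> - \<zeta>)"
    using \<open>mirror_assumption1 N X chi \<psi>s L_chi\<close> by (auto simp: mirror_assumption1_def)
  have G: "GDERIV \<psi>s \<xi> :> chi \<xi>" for \<xi>
    using GDERIV_grad[OF psi(2)] psi(3) by simp
  \<comment> \<open>A positive Lipschitz constant of \<open>chi\<close> in which \<open>L_R / \<gamma>\<close> is exactly \<open>1 / L\<close>; \<open>L_chi\<close> itself could be zero.\<close>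
  define L where "L = \<gamma> / L_R"
  have L_R: "L_R > 0" using \<open>0 < l_R\<close> \<open>l_R \<le> L_R\<close> by simp
  have L: "L > 0" using L_R \<open>\<gamma> > 0\<close> by (simp add: L_def)
  have "L_chi \<le> L" using \<open>\<gamma> \<ge> L_R * L_chi\<close> L_R by (simp add: L_def field_simps)
  then have Lip': "N (chi \<xi> - chi \<omega>) \<le> L * dual_norm N (\<xi> - \<omega>)" for \<xi> \<omega>
    using Lip[of \<xi> \<omega>] dual_norm_nonneg[OF N, of "\<xi> - \<omega>"]
      mult_right_mono[of L_chi L "dual_norm N (\<xi> - \<omega>)"] by linarith
  have amdr: "x 0 \<in> X" "y k = x k + (r / (r + real k)) *\<^sub>R (chi (\<zeta> k) - x k)"
    "\<zeta> (Suc k) = \<zeta> k - (real k * h / r) *\<^sub>R grad f (y k)"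
    "is_arg_min (\<lambda>u. \<gamma> * h * (grad f (y k) \<bullet> u) + R u (y k)) (\<lambda>u. u \<in> X) (x (Suc k))" for k
    using \<open>AMDR X f chi R h r \<gamma> x y \<zeta>\<close> unfolding AMDR_def by blast+
  have xX: "x k \<in> X" for k
    using amdr(1) amdr(4)[of "k - 1"] by (cases k) (auto simp: is_arg_min_def)
  have xsX: "xstar \<in> X" using \<open>is_arg_min f (\<lambda>u. u \<in> X) xstar\<close> by (simp add: is_arg_min_def)
  define g z z' where "g = grad f (y k)" and "z = chi (\<zeta> k)" and "z' = chi (\<zeta> (Suc k))"
  \<comment> \<open>The primal estimate is scaled by \<open>s\<close>, so that its linear term matches the dual step \<open>s * r = k * h / r\<close>;
    for \<open>k = 0\<close> both vanish.\<close>
  define s where "s = real k * h / r\<^sup>2"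
  define e2 where "e2 = (N (z - z'))\<^sup>2"
  have s: "s \<ge> 0" using \<open>h > 0\<close> by (simp add: s_def)
  have sr: "s * r = real k * h / r" using \<open>r > 0\<close> by (simp add: s_def power2_eq_square)
  have coco: "\<psi>s (\<zeta> (Suc k)) + z' \<bullet> (\<zeta> k - \<zeta> (Suc k)) + e2 / (2 * L) \<le> \<psi>s (\<zeta> k)"
    unfolding z_def z'_def e2_def by (rule convex_cocoercive[OF N L psi(1) G Lip'])
  have \<zeta>_step: "\<zeta> k - \<zeta> (Suc k) = (s * r) *\<^sub>R g"
    unfolding sr g_def amdr(3) by simp
  have breg: "bregman \<phi> xstar (chi \<xi>) = real_of_ereal (\<phi> xstar) + \<psi>s \<xi> - \<xi> \<bullet> xstar" for \<xi>
    by (rule bregman_mirror_eq_conjugate[OF X xsX psi(1) G]) fact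
  have "bregman \<phi> xstar z' - bregman \<phi> xstar z
      = \<psi>s (\<zeta> (Suc k)) - \<psi>s (\<zeta> k) + (\<zeta> k - \<zeta> (Suc k)) \<bullet> xstar"
    by (simp add: z_def z'_def breg inner_diff_left)
  with coco have dual: "bregman \<phi> xstar z' - bregman \<phi> xstar z
      \<le> s * r * (g \<bullet> (xstar - z')) - e2 / (2 * L)"
    unfolding \<zeta>_step by (simp add: inner_diff_right inner_commute algebra_simps)
  have "(real k + r) * (f (x (Suc k)) - f xstar) - real k * (f (x k) - f xstar)
        + r * (g \<bullet> (xstar - z'))
      \<le> r\<^sup>2 * L_R / (2 * (\<gamma> * h) * (real k + r)) * e2"
    unfolding g_def e2_def
  proof (rule mirror_step_estimate[where X = X and U = U and R = R and L_f = L_f and l_R = l_R])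
    show "GDERIV f u :> grad f u" if "u \<in> U" for u
      using GDERIV_grad that assms by blast
    show "2 * L_f * (\<gamma> * h) \<le> l_R"
      using \<open>h \<le> l_R / (2 * L_f * \<gamma>)\<close> \<open>L_f > 0\<close> \<open>\<gamma> > 0\<close> by (simp add: field_simps)
    show "\<gamma> * h > 0" using \<open>\<gamma> > 0\<close> \<open>h > 0\<close> by simp
    show "y k = x k + (r / (r + real k)) *\<^sub>R (z - x k)"
      unfolding z_def by (rule amdr)
  qed (use assms xX xsX chiX amdr(4) in \<open>auto simp: z_def z'_def\<close>)
  from mult_left_mono[OF this s]
  have "s * ((real k + r) * (f (x (Suc k)) - f xstar) - real k * (f (x k) - f xstar))
        + s * r * (g \<bullet> (xstar - z'))
      \<le> s * (r\<^sup>2 * L_R / (2 * (\<gamma> * h) * (real k + r)) * e2)"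
    by (simp add: algebra_simps)
  also have "\<dots> = real k / (real k + r) * (e2 / (2 * L))"
    using \<open>r > 0\<close> \<open>h > 0\<close> \<open>\<gamma> > 0\<close> L_R by (simp add: s_def L_def mult_ac)
  also have "\<dots> \<le> 1 * (e2 / (2 * L))"
    using \<open>r > 0\<close> L by (intro mult_right_mono) (auto simp: e2_def)
  finally have decrease: "s * ((real k + r) * (f (x (Suc k)) - f xstar) - real k * (f (x k) - f xstar))
      + (bregman \<phi> xstar z' - bregman \<phi> xstar z) \<le> 0"
    using dual by linarith
  have weights: "((real k + 1) * \<delta>)\<^sup>2 / r\<^sup>2 * A - (real k * \<delta>)\<^sup>2 / r\<^sup>2 * B
      = (2 * real k + 1 - real k * r) * h / r\<^sup>2 * A + s * ((real k + r) * A - real k * B)" for A B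
    using \<open>\<delta> = sqrt h\<close> \<open>h > 0\<close> \<open>r > 0\<close>
    by (simp add: s_def power_mult_distrib field_simps) (simp add: power2_eq_square algebra_simps)
  show ?thesis
    unfolding V_hat_def Suc_eq_plus1[symmetric] z_def[symmetric] z'_def[symmetric]
    using decrease weights[of "f (x (Suc k)) - f xstar" "f (x k) - f xstar"] by linarith
qed

end
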